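(* Let $\mathcal{A}$ be a $\mathbb{Z}_2$-graded $\Omega$-algebra which is graded-simple, over a field $\mathbb{F}$ of characteristic not $2$. Then either $\mathcal{A}$ is simple as an $\Omega$-algebra, or $\mathcal{A}\cong_2\mathcal{B}\otimes\mathbb{F}\mathbb{Z}_2$ as $\Omega'$-algebras, where $\mathcal{B}$ is a simple $\Omega'$-algebra and $\Omega'=(\Omega_0\cap\mathcal{A}^0)\cup\bigcup_{n>0}\Omega_n$.
   Context: $\Omega=\bigcup_{n\ge0}\Omega_n$ is a signature with $\Omega_n\ne\emptyset$ for some $n\ge2$. An $\Omega$-algebra is an $\mathbb{F}$-vector space $\mathcal{A}$ in which each $\omega\in\Omega_n$ defines an $n$-linear operation $\mathcal{A}^n\to\mathcal{A}$ (an element of $\mathcal{A}$ if $n=0$). $\Omega_0\cap\mathcal{A}^0$ is the set of those $\mu\in\Omega_0$ whose value in $\mathcal{A}$ lies in $\mathcal{A}^0$. A subspace $I\subseteq\mathcal{A}$ is an ideal if $\omega(a_1,\dots,a_n)\in I$ for all $n\ge1$, $\omega\in\Omega_n$, whenever some $a_s\in I$. $\mathbb{F}_\Omega\langle X\rangle$ is the free $\Omega$-algebra on $X$. For $S_1,S_2\subseteq\mathcal{A}$, $S_1\cdot S_2$ is the span of all $f(s_1,s_2,a_1,\dots,a_r)$ with $s_i\in S_i$, $a_j\in\mathcal{A}$ and $f(x_1,x_2,y_1,\dots,y_r)\in\mathbb{F}_\Omega\langle X\rangle$ linear in $x_1$ and in $x_2$; $S^2=S\cdot S$. $\mathcal{A}$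 is simple if $\mathcal{A}^2\ne0$ and $\mathcal{A}$ has no ideals other than $0$ and $\mathcal{A}$. A $\mathbb{Z}_2$-grading is a vector space decomposition $\mathcal{A}=\mathcal{A}^0\oplus\mathcal{A}^1$ with $\omega(\mathcal{A}^{i_1},\dots,\mathcal{A}^{i_n})\subseteq\mathcal{A}^{i_1+\cdots+i_n}$ for all $\omega\in\Omega_n$ (indices mod 2). $\mathcal{A}$ is graded-simple if $\mathcal{A}^2\ne0$ and it has no graded ideals other than $0$ and $\mathcal{A}$. $\cong_2$ denotes isomorphism of $\mathbb{Z}_2$-graded algebras of the indicated signature. For an $\Omega$-algebra $\mathcal{B}$ (similarly for $\Omega'$), $\mathcal{B}\otimes\mathbb{F}\mathbb{Z}_2=\mathcal{B}\oplus\varepsilon\mathcal{B}$ (with $\varepsilon b=b\otimes\varepsilon$) has even part $\mathcal{B}$, odd part $\varepsilon\mathcal{B}$ and operations $\omega(\varepsilon^{i_1}b_1,\dots,\varepsilon^{i_n}b_n)=\varepsilon^{i_1+\cdots+i_n}\omega(b_1,\dots,b_n)$, where $\varepsilon^j=1$ for $j$ even and $\varepsilon^j=\varepsilon$ for $j$ odd. *)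

theory Defs
  imports
    "HOL-Library.Z2"
    "HOL-Library.Product_Plus"
    "HOL-Library.Poly_Mapping"
    "HOL-Computational_Algebra.Computational_Algebra"
begin

text \<open>
  A signature assigns to each \<open>n\<close> the set of its \<open>n\<close>-ary operation symbols. Argument tuples
  are lists, so \<open>\<omega> \<in> \<Omega> n\<close> is applied to lists of length \<open>n\<close>.
\<close>

type_synonym 'w signature = "nat \<Rightarrow> 'w set"

text \<open>
  The underlying vector space is a subspace \<open>carr\<close> of an ambient vector space on a type \<open>'a\<close>.
  Operations and their laws only matter on the carrier.
\<close>

record ('f, 'a, 'w) omega_alg =
  carr :: "'a set"
  vscale :: "'f \<Rightarrow> 'a \<Rightarrow> 'a"
  oper :: "'w \<Rightarrow> 'a list \<Rightarrow> 'a"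

locale omega_algebra = vector_space "vscale A"
  for \<Omega> :: "'w signature" and A :: "('f::field, 'a::ab_group_add, 'w) omega_alg" +
  assumes subspace_carr: "subspace (carr A)"
    and oper_closed: "\<And>w xs. w \<in> \<Omega> (length xs) \<Longrightarrow> set xs \<subseteq> carr A \<Longrightarrow> oper A w xs \<in> carr A"
    and oper_add: "\<And>w xs x y ys. w \<in> \<Omega> (length xs + 1 + length ys) \<Longrightarrow>
        set xs \<subseteq> carr A \<Longrightarrow> set ys \<subseteq> carr A \<Longrightarrow> x \<in> carr A \<Longrightarrow> y \<in> carr A \<Longrightarrow>
        oper A w (xs @ (x + y) # ys) = oper A w (xs @ x # ys) + oper A w (xs @ y # ys)"
    and oper_scale: "\<And>w xs c x ys. w \<in> \<Omega> (length xs + 1 + length ys) \<Longrightarrow>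
        set xs \<subseteq> carr A \<Longrightarrow> set ys \<subseteq> carr A \<Longrightarrow> x \<in> carr A \<Longrightarrow>
        oper A w (xs @ vscale A c x # ys) = vscale A c (oper A w (xs @ x # ys))"

definition omega_hom ::
  "'w signature \<Rightarrow> ('f::field, 'a::ab_group_add, 'w) omega_alg
    \<Rightarrow> ('f, 'b::ab_group_add, 'w) omega_alg \<Rightarrow> ('a \<Rightarrow> 'b) \<Rightarrow> bool" where
  "omega_hom \<Omega> A B h \<longleftrightarrow>
     h ` carr A \<subseteq> carr B \<and>
     (\<forall>x\<in>carr A. \<forall>y\<in>carr A. h (x + y) = h x + h y) \<and>
     (\<forall>c. \<forall>x\<in>carr A. h (vscale A c x) = vscale B c (h x)) \<and>
     (\<forall>xs. \<forall>w\<in>\<Omega> (length xs). set xs \<subseteq> carr A \<longrightarrow> h (oper A w xs) = oper B w (map h xs))"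

definition omega_ideal ::
  "'w signature \<Rightarrow> ('f::field, 'a::ab_group_add, 'w) omega_alg \<Rightarrow> 'a set \<Rightarrow> bool" where
  "omega_ideal \<Omega> A I \<longleftrightarrow>
     module.subspace (vscale A) I \<and> I \<subseteq> carr A \<and>
     (\<forall>n\<ge>1. \<forall>w\<in>\<Omega> n. \<forall>xs. length xs = n \<longrightarrow> set xs \<subseteq> carr A \<longrightarrow> (\<exists>x\<in>set xs. x \<in> I)
        \<longrightarrow> oper A w xs \<in> I)"


subsection \<open>The free algebra\<close>

text \<open>
  The free \<open>\<Omega>\<close>-algebra on \<open>X\<close> is the vector space with basis the nonassociative monomials,
  i.e. the \<open>\<Omega>\<close>-terms over \<open>X\<close>; its operations extend term formation multilinearly.
\<close>

datatype ('w, 'x) omega_monomial = Var 'x | App 'w "('w, 'x) omega_monomial list"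

inductive_set omega_monomials :: "'w signature \<Rightarrow> 'x set \<Rightarrow> ('w, 'x) omega_monomial set"
  for \<Omega> :: "'w signature" and X :: "'x set" where
  Var: "x \<in> X \<Longrightarrow> Var x \<in> omega_monomials \<Omega> X"
| App: "w \<in> \<Omega> (length ts) \<Longrightarrow> (\<And>t. t \<in> set ts \<Longrightarrow> t \<in> omega_monomials \<Omega> X)
        \<Longrightarrow> App w ts \<in> omega_monomials \<Omega> X"

type_synonym ('f, 'w, 'x) omega_poly = "('w, 'x) omega_monomial \<Rightarrow>\<^sub>0 'f"

definition free_omega_algebra ::
  "'w signature \<Rightarrow> 'x set \<Rightarrow> ('f::field, ('f, 'w, 'x) omega_poly, 'w) omega_alg" where
  "free_omega_algebra \<Omega> X =
     \<lparr> carr = {f. Poly_Mapping.keys f \<subseteq> omega_monomials \<Omega> X},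
       vscale = (\<lambda>c. Poly_Mapping.map ((*) c)),
       oper = (\<lambda>w fs. \<Sum>ts\<in>listset (map Poly_Mapping.keys fs).
         Poly_Mapping.single (App w ts) (prod_list (map2 Poly_Mapping.lookup fs ts))) \<rparr>"

primrec monomial_eval ::
  "('f, 'a, 'w) omega_alg \<Rightarrow> ('x \<Rightarrow> 'a) \<Rightarrow> ('w, 'x) omega_monomial \<Rightarrow> 'a" where
  "monomial_eval A v (Var x) = v x"
| "monomial_eval A v (App w ts) = oper A w (map (monomial_eval A v) ts)"

text \<open>The value \<open>f(v)\<close>: the image of \<open>f\<close> under the homomorphism extending \<open>v\<close>.\<close>

definition poly_eval ::
  "('f::field, 'a::ab_group_add, 'w) omega_alg \<Rightarrow> ('x \<Rightarrow> 'a) \<Rightarrow> ('f, 'w, 'x) omega_poly \<Rightarrow> 'a" where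
  "poly_eval A v f =
     (\<Sum>t\<in>Poly_Mapping.keys f. vscale A (Poly_Mapping.lookup f t) (monomial_eval A v t))"

primrec degree_in :: "'x \<Rightarrow> ('w, 'x) omega_monomial \<Rightarrow> nat" where
  "degree_in x (Var y) = (if x = y then 1 else 0)"
| "degree_in x (App w ts) = sum_list (map (degree_in x) ts)"

definition linear_in :: "'x \<Rightarrow> ('f::field, 'w, 'x) omega_poly \<Rightarrow> bool" where
  "linear_in x f \<longleftrightarrow> (\<forall>t\<in>Poly_Mapping.keys f. degree_in x t = 1)"


subsection \<open>Products of subsets and simplicity\<close>

datatype prod_var = X1 | X2 | Y nat

text \<open>
  Each \<open>f\<close> involves only finitely many of the variables \<open>Y j\<close>, so evaluating at a total
  assignment is the same as evaluating at \<open>(s1, s2, a1, \<dots>, ar)\<close>.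
\<close>

definition set_product ::
  "'w signature \<Rightarrow> ('f::field, 'a::ab_group_add, 'w) omega_alg \<Rightarrow> 'a set \<Rightarrow> 'a set \<Rightarrow> 'a set" where
  "set_product \<Omega> A S1 S2 = module.span (vscale A)
     {poly_eval A v f | v f.
        f \<in> carr (free_omega_algebra \<Omega> (UNIV :: prod_var set)) \<and>
        linear_in X1 f \<and> linear_in X2 f \<and>
        v X1 \<in> S1 \<and> v X2 \<in> S2 \<and> (\<forall>j. v (Y j) \<in> carr A)}"

definition simple_algebra ::
  "'w signature \<Rightarrow> ('f::field, 'a::ab_group_add, 'w) omega_alg \<Rightarrow> bool" where
  "simple_algebra \<Omega> A \<longleftrightarrow> omega_algebra \<Omega> A \<and>
     set_product \<Omega> A (carr A) (carr A) \<noteq> {0} \<and>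
     (\<forall>I. omega_ideal \<Omega> A I \<longrightarrow> I = {0} \<or> I = carr A)"


subsection \<open>Gradings by the group of order two\<close>

text \<open>
  The degree condition is imposed on operations of positive arity only; the values of nullary
  symbols are arbitrary elements, not necessarily even or homogeneous.
\<close>

definition z2_grading ::
  "'w signature \<Rightarrow> ('f::field, 'a::ab_group_add, 'w) omega_alg \<Rightarrow> (bit \<Rightarrow> 'a set) \<Rightarrow> bool" where
  "z2_grading \<Omega> A G \<longleftrightarrow>
     (\<forall>i. module.subspace (vscale A) (G i)) \<and>
     carr A = {x + y | x y. x \<in> G 0 \<and> y \<in> G 1} \<and> G 0 \<inter> G 1 = {0} \<and>
     (\<forall>n\<ge>1. \<forall>w\<in>\<Omega> n. \<forall>is xs. length is = n \<longrightarrow> list_all2 (\<lambda>i x. x \<in> G i) is xs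
        \<longrightarrow> oper A w xs \<in> G (sum_list is))"

definition graded_subset :: "(bit \<Rightarrow> 'a::ab_group_add set) \<Rightarrow> 'a set \<Rightarrow> bool" where
  "graded_subset G I \<longleftrightarrow> I = {x + y | x y. x \<in> I \<inter> G 0 \<and> y \<in> I \<inter> G 1}"

definition graded_simple ::
  "'w signature \<Rightarrow> ('f::field, 'a::ab_group_add, 'w) omega_alg \<Rightarrow> (bit \<Rightarrow> 'a set) \<Rightarrow> bool" where
  "graded_simple \<Omega> A G \<longleftrightarrow> omega_algebra \<Omega> A \<and> z2_grading \<Omega> A G \<and>
     set_product \<Omega> A (carr A) (carr A) \<noteq> {0} \<and>
     (\<forall>I. omega_ideal \<Omega> A I \<and> graded_subset G I \<longrightarrow> I = {0} \<or> I = carr A)"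

definition graded_isomorphic ::
  "'w signature \<Rightarrow> ('f::field, 'a::ab_group_add, 'w) omega_alg \<Rightarrow> (bit \<Rightarrow> 'a set)
    \<Rightarrow> ('f, 'b::ab_group_add, 'w) omega_alg \<Rightarrow> (bit \<Rightarrow> 'b set) \<Rightarrow> bool" where
  "graded_isomorphic \<Omega> A G B H \<longleftrightarrow>
     (\<exists>h. omega_hom \<Omega> A B h \<and> bij_betw h (carr A) (carr B) \<and> (\<forall>i. h ` G i = H i))"

text \<open>
  The pair \<open>(b, c)\<close> stands for \<open>b + \<epsilon>c\<close>, so \<open>eps i b\<close> is \<open>b\<close> or \<open>\<epsilon>b\<close>. An operation on pairs is the
  multilinear extension of \<open>\<omega>(eps i1 b1, \<dots>, eps in bn) = eps (i1 + \<dots> + in) (\<omega>(b1, \<dots>, bn))\<close>: the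
  sum over all ways \<open>is\<close> of selecting one component of each argument.
\<close>

definition eps :: "bit \<Rightarrow> 'a::zero \<Rightarrow> 'a \<times> 'a" where
  "eps i b = (if i = 0 then (b, 0) else (0, b))"

definition component :: "bit \<Rightarrow> 'a \<times> 'a \<Rightarrow> 'a" where
  "component i p = (if i = 0 then fst p else snd p)"

definition tensor_FZ2 ::
  "('f::field, 'a::ab_group_add, 'w) omega_alg \<Rightarrow> ('f, 'a \<times> 'a, 'w) omega_alg" where
  "tensor_FZ2 B =
     \<lparr> carr = carr B \<times> carr B,
       vscale = (\<lambda>c p. (vscale B c (fst p), vscale B c (snd p))),
       oper = (\<lambda>w ps. \<Sum>is | length is = length ps.
         eps (sum_list is) (oper B w (map2 component is ps))) \<rparr>"

definition tensor_FZ2_grading ::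
  "('f::field, 'a::ab_group_add, 'w) omega_alg \<Rightarrow> bit \<Rightarrow> ('a \<times> 'a) set" where
  "tensor_FZ2_grading B i = eps i ` carr B"

definition even_constants_signature ::
  "'w signature \<Rightarrow> ('f, 'a, 'w) omega_alg \<Rightarrow> (bit \<Rightarrow> 'a set) \<Rightarrow> 'w signature" where
  "even_constants_signature \<Omega> A G =
     (\<lambda>n. if n = 0 then {\<mu> \<in> \<Omega> 0. oper A \<mu> [] \<in> G 0} else \<Omega> n)"

end

theory Submission
  imports Defs
begin

text \<open>
  Suppose that \<open>A\<close> is graded-simple but has an ideal \<open>I\<close> with \<open>0 \<noteq> I \<noteq> A\<close>. Both
  \<open>(I \<inter> A\<^sup>0) + (I \<inter> A\<^sup>1)\<close>, the largest graded ideal inside \<open>I\<close>, and \<open>p\<^sub>0(I) + p\<^sub>1(I)\<close>, the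
  smallest graded ideal containing \<open>I\<close> (with \<open>p\<^sub>i\<close> the projections to the homogeneous
  components), are trivial by graded-simplicity. The first must be \<open>0\<close>, the second must be \<open>A\<close>.
  Together this says that every coset of \<open>I\<close> contains exactly one even and exactly one odd
  element, so that \<open>A\<^sup>0\<close> and \<open>A\<^sup>1\<close> are both copies of \<open>A/I\<close>.

  Let \<open>T x\<close> be the even element of the coset of \<open>x\<close>. As \<open>I\<close> is an ideal and \<open>A\<^sup>0\<close> is closed under
  the operations of \<open>\<Omega>'\<close>, the map \<open>T\<close> is a homomorphism from \<open>A\<close> onto \<open>B = A\<^sup>0\<close>; it is the
  quotient map \<open>A \<rightarrow> A/I\<close> in disguise. It restricts to the identity on \<open>A\<^sup>0\<close> and to a linear
  bijection \<open>A\<^sup>1 \<rightarrow> A\<^sup>0\<close>. Hence \<open>x \<mapsto> T (p\<^sub>0 x) + \<epsilon> T (p\<^sub>1 x)\<close> is a graded bijection of \<open>A\<close> onto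
  \<open>B \<otimes> F Z\<^sub>2\<close>, and expanding an operation multilinearly into homogeneous components shows that it
  is a homomorphism. The constants of \<open>B \<otimes> F Z\<^sub>2\<close> are even by definition, so a constant of \<open>A\<close> with a
  nonzero odd part cannot be preserved; this is why the signature shrinks to \<open>\<Omega>'\<close>.

  Simplicity of \<open>B\<close> follows by pulling an ideal \<open>J\<close> of \<open>B\<close> back to the graded ideal of those
  elements of \<open>A\<close> both of whose homogeneous components are sent into \<open>J\<close> by \<open>T\<close>. That
  \<open>B\<^sup>2 \<noteq> 0\<close> uses a description of this condition without polynomials: it says that some
  operation of arity at least two is nonzero
  (\<open>set_product_nonzero_iff\<close>). In this form it clearly passes from \<open>A\<close> to \<open>B\<close>, although the
  polynomials over \<open>\<Omega>\<close> may involve constants that \<open>\<Omega>'\<close> lacks.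
\<close>

section \<open>Multilinearity and the condition of nonzero square\<close>

lemma UNIV_bit: "(UNIV :: bit set) = {0, 1}"
proof -
  have "x = 0 \<or> x = 1" for x :: bit by (cases x) auto
  then show ?thesis by auto
qed

lemma finite_bit_lists: "finite {js :: bit list. length js = n}"
proof -
  have "finite (UNIV :: bit set)" by (simp add: UNIV_bit)
  from finite_lists_length_eq[OF this, of n] show ?thesis by simp
qed

lemma sum_list_update_add:
  fixes js :: "'a::comm_monoid_add list"
  assumes "k < length js"
  shows "sum_list (js[k := js ! k + d]) = sum_list js + d"
  using assms
proof (induction js arbitrary: k)
  case (Cons j js)
  then show ?case by (cases k) (simp_all add: ac_simps)
qed simp

lemma sum_bit_lists_Suc:
  fixes g :: "bit list \<Rightarrow> 'a::comm_monoid_add"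
  shows "(\<Sum>js | length js = Suc n. g js)
    = (\<Sum>js | length js = n. g (0 # js)) + (\<Sum>js | length js = n. g (1 # js))"
proof -
  have split: "{js. length js = Suc n}
      = (#) (0::bit) ` {js. length js = n} \<union> (#) 1 ` {js. length js = n}"
  proof (rule set_eqI)
    fix js :: "bit list"
    show "js \<in> {js. length js = Suc n} \<longleftrightarrow>
        js \<in> (#) 0 ` {js. length js = n} \<union> (#) 1 ` {js. length js = n}"
      by (cases js) (auto simp: image_iff)
  qed
  show ?thesis
    unfolding split
    by (subst sum.union_disjoint) (auto simp: finite_bit_lists sum.reindex)
qed

context omega_algebra
begin

lemma omega_ideal_oper:
  assumes "omega_ideal \<Omega> A I" "w \<in> \<Omega> (length xs)" "set xs \<subseteq> carr A" "x \<in> set xs" "x \<in> I"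
  shows "oper A w xs \<in> I"
proof -
  have "1 \<le> length xs" using assms(4) by (cases xs) auto
  then show ?thesis using assms unfolding omega_ideal_def by blast
qed

lemma zero_carr: "0 \<in> carr A"
  using subspace_carr by (rule subspace_0)

lemma oper_zero_arg:
  assumes "w \<in> \<Omega> (length xs + 1 + length ys)" "set xs \<subseteq> carr A" "set ys \<subseteq> carr A"
  shows "oper A w (xs @ 0 # ys) = 0"
  using oper_scale[OF assms zero_carr, of 0] by simp

lemma oper_diff_arg:
  assumes "w \<in> \<Omega> (length xs + 1 + length ys)" "set xs \<subseteq> carr A" "set ys \<subseteq> carr A"
    and "x \<in> carr A" "y \<in> carr A"
  shows "oper A w (xs @ (x - y) # ys) = oper A w (xs @ x # ys) - oper A w (xs @ y # ys)"
  using oper_add[OF assms(1-3) subspace_diff[OF subspace_carr assms(4,5)] assms(5)] by simp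

text \<open>
  Multilinear expansion, for arguments that are split into two components each. The fixed
  initial arguments \<open>zs\<close> make the induction on \<open>xs\<close> possible.
\<close>

lemma oper_expand_aux:
  assumes p_carr: "\<And>i x. x \<in> carr A \<Longrightarrow> p i x \<in> carr A"
    and p_sum: "\<And>x. x \<in> carr A \<Longrightarrow> p 0 x + p 1 x = x"
  shows "w \<in> \<Omega> (length zs + length xs) \<Longrightarrow> set zs \<subseteq> carr A \<Longrightarrow> set xs \<subseteq> carr A \<Longrightarrow>
    oper A w (zs @ xs) = (\<Sum>js | length js = length xs. oper A w (zs @ map2 p (js :: bit list) xs))"
proof (induction xs arbitrary: zs)
  case Nil
  then show ?case by simp
next
  case (Cons x xs)
  have x: "x \<in> carr A" and xs: "set xs \<subseteq> carr A" using Cons.prems by auto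
  have step: "oper A w (zs @ p i x # xs)
      = (\<Sum>js | length js = length xs. oper A w (zs @ map2 p (i # js) (x # xs)))" for i
    using Cons.IH[of "zs @ [p i x]"] Cons.prems p_carr[OF x] xs by simp
  have "oper A w (zs @ x # xs) = oper A w (zs @ p 0 x # xs) + oper A w (zs @ p 1 x # xs)"
    using oper_add[of w zs xs "p 0 x" "p 1 x"] Cons.prems p_carr[OF x] p_sum[OF x] xs by simp
  then show ?case
    by (simp only: step length_Cons sum_bit_lists_Suc)
qed

lemma oper_expand:
  assumes "\<And>i x. x \<in> carr A \<Longrightarrow> p i x \<in> carr A"
    and "\<And>x. x \<in> carr A \<Longrightarrow> p 0 x + p 1 x = x"
    and "w \<in> \<Omega> (length xs)" "set xs \<subseteq> carr A"
  shows "oper A w xs = (\<Sum>js | length js = length xs. oper A w (map2 p (js :: bit list) xs))"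
  using oper_expand_aux[OF assms(1,2), of w "[]" xs] assms(3,4) by simp

text \<open>
  Congruence modulo an ideal, by exchanging the arguments one at a time; \<open>zs\<close> holds the
  arguments that have already been exchanged.
\<close>

lemma oper_cong_ideal_aux:
  assumes I: "omega_ideal \<Omega> A I"
  shows "list_all2 (\<lambda>x y. x \<in> carr A \<and> y \<in> carr A \<and> x - y \<in> I) xs ys \<Longrightarrow>
    w \<in> \<Omega> (length zs + length xs) \<Longrightarrow> set zs \<subseteq> carr A \<Longrightarrow>
    oper A w (zs @ xs) - oper A w (zs @ ys) \<in> I"
proof (induction xs ys arbitrary: zs rule: list_all2_induct)
  case Nil
  then show ?case using I by (simp add: omega_ideal_def subspace_0)
next
  case (Cons x xs y ys)
  have x: "x \<in> carr A" and y: "y \<in> carr A" and xy: "x - y \<in> I" using Cons by auto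
  have xs: "set xs \<subseteq> carr A"
    using \<open>list_all2 _ xs ys\<close> by (induction rule: list_all2_induct) auto
  have diff: "x - y \<in> carr A" using x y subspace_carr by (simp add: subspace_diff)
  have "oper A w (zs @ (x - y) # xs) \<in> I"
    by (rule omega_ideal_oper[OF I, where x = "x - y"]) (use xy xs Cons.prems diff in auto)
  moreover have "oper A w (zs @ (x - y) # xs)
      = oper A w (zs @ x # xs) - oper A w (zs @ y # xs)"
    using oper_diff_arg[of w zs xs x y] Cons.prems x y xs by simp
  moreover have "oper A w (zs @ y # xs) - oper A w (zs @ y # ys) \<in> I"
    using Cons.IH[of "zs @ [y]"] Cons.prems y by simp
  ultimately have "(oper A w (zs @ x # xs) - oper A w (zs @ y # xs))
      + (oper A w (zs @ y # xs) - oper A w (zs @ y # ys)) \<in> I"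
    using I unfolding omega_ideal_def by (metis subspace_add)
  then show ?case by simp
qed

lemma oper_cong_ideal:
  assumes "omega_ideal \<Omega> A I" "w \<in> \<Omega> (length xs)"
    and "list_all2 (\<lambda>x y. x \<in> carr A \<and> y \<in> carr A \<and> x - y \<in> I) xs ys"
  shows "oper A w xs - oper A w ys \<in> I"
  using oper_cong_ideal_aux[OF assms(1,3), of w "[]"] assms(2) by simp

lemma monomial_eval_carr:
  assumes "t \<in> omega_monomials \<Omega> X" "\<And>x. v x \<in> carr A"
  shows "monomial_eval A v t \<in> carr A"
  using assms(1) by induction (auto simp: assms(2) intro!: oper_closed)

text \<open>
  A monomial containing two different variables has to branch somewhere, and if its value is
  nonzero then so is the value of each of its submonomials.
\<close>

lemma monomial_eval_nonzero_branch:
  assumes "t \<in> omega_monomials \<Omega> X" "\<And>x. v x \<in> carr A" "x \<noteq> y"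
    and "degree_in x t = 1" "degree_in y t = 1" "monomial_eval A v t \<noteq> 0"
  shows "\<exists>w xs. 2 \<le> length xs \<and> w \<in> \<Omega> (length xs) \<and> set xs \<subseteq> carr A \<and> oper A w xs \<noteq> 0"
  using assms(1,4-6)
proof induction
  case (Var z)
  have "x = z" using Var.prems(1) by (cases "x = z") simp_all
  moreover have "y = z" using Var.prems(2) by (cases "y = z") simp_all
  ultimately show ?case using assms(3) by blast
next
  case (App w ts)
  consider "ts = []" | t where "ts = [t]" | "2 \<le> length ts"
    by (cases ts; cases "tl ts") auto
  then show ?case
  proof cases
    case 1
    with App.prems show ?thesis by simp
  next
    case 2
    have "monomial_eval A v t \<noteq> 0"
      using App.prems(3) oper_zero_arg[of w "[]" "[]"] App.hyps(1) 2 by auto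
    then show ?thesis using App.IH[of t] App.prems 2 by simp
  next
    case 3
    have "set (map (monomial_eval A v) ts) \<subseteq> carr A"
      using App.hyps(2) monomial_eval_carr assms(2) by auto
    then show ?thesis using App.prems(3) App.hyps(1) 3
      by (intro exI[of _ w] exI[of _ "map (monomial_eval A v) ts"]) simp
  qed
qed

text \<open>
  This removes the free algebra from the nondegeneracy condition. An operation of arity at least
  two is itself the value of a monomial linear in its first two variables, and the converse is
  the preceding lemma.
\<close>

lemma set_product_nonzero_iff:
  "set_product \<Omega> A (carr A) (carr A) \<noteq> {0} \<longleftrightarrow>
    (\<exists>w xs. 2 \<le> length xs \<and> w \<in> \<Omega> (length xs) \<and> set xs \<subseteq> carr A \<and> oper A w xs \<noteq> 0)"
  (is "?L \<longleftrightarrow> ?R")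
proof
  assume ?L
  moreover have "span S = {0}" if "S \<subseteq> {0}" for S
    using span_mono[OF that] span_zero[of S] by auto
  ultimately have "\<not> {poly_eval A v f | v f.
        f \<in> carr (free_omega_algebra \<Omega> (UNIV :: prod_var set)) \<and>
        linear_in X1 f \<and> linear_in X2 f \<and>
        v X1 \<in> carr A \<and> v X2 \<in> carr A \<and> (\<forall>j. v (Y j) \<in> carr A)} \<subseteq> {0}"
    unfolding set_product_def by blast
  then obtain v f where f: "f \<in> carr (free_omega_algebra \<Omega> (UNIV :: prod_var set))"
      "linear_in X1 f" "linear_in X2 f"
    and v: "v X1 \<in> carr A" "v X2 \<in> carr A" "\<And>j. v (Y j) \<in> carr A"
    and nz: "poly_eval A v f \<noteq> 0" by auto
  have v: "v x \<in> carr A" for x by (cases x) (auto simp: v)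
  from nz obtain t where t: "t \<in> Poly_Mapping.keys f" "monomial_eval A v t \<noteq> 0"
    unfolding poly_eval_def by (auto elim: sum.not_neutral_contains_not_neutral)
  show ?R
    by (rule monomial_eval_nonzero_branch[of t UNIV v X1 X2])
       (use t f v in \<open>auto simp: free_omega_algebra_def linear_in_def\<close>)
next
  assume ?R
  then obtain w xs where xs: "2 \<le> length xs" "w \<in> \<Omega> (length xs)" "set xs \<subseteq> carr A"
    and nz: "oper A w xs \<noteq> 0" by blast
  from xs(1) obtain a b cs where xs_eq: "xs = a # b # cs"
    by (metis One_nat_def Suc_1 Suc_le_length_iff)
  \<comment> \<open>The monomial \<open>w(x\<^sub>1, x\<^sub>2, y\<^sub>0, y\<^sub>1, \<dots>)\<close>, evaluated at \<open>xs\<close>. The default \<open>0\<close> is only there to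
      give the remaining variables values in the carrier.\<close>
  define t where "t = App w (map Var (X1 # X2 # map Y [0..<length cs]))"
  define v where "v = case_prod_var a b (\<lambda>j. if j < length cs then cs ! j else 0)"
  define f :: "('f, 'w, prod_var) omega_poly" where "f = Poly_Mapping.single t 1"
  have "map (monomial_eval A v \<circ> Var \<circ> Y) [0..<length cs] = cs"
    by (rule nth_equalityI) (auto simp: v_def)
  then have "monomial_eval A v t = oper A w xs"
    by (simp add: t_def xs_eq v_def comp_assoc)
  then have eval: "poly_eval A v f = oper A w xs"
    by (simp add: poly_eval_def f_def)
  have t_mon: "t \<in> omega_monomials \<Omega> UNIV"
    unfolding t_def using xs(2) xs_eq by (auto intro!: omega_monomials.intros)
  have degree: "degree_in X1 t = 1" "degree_in X2 t = 1"
    by (auto simp: t_def comp_def)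
  have "oper A w xs \<in> set_product \<Omega> A (carr A) (carr A)"
    unfolding set_product_def
  proof (rule span_base, rule CollectI, intro exI[of _ v] exI[of _ f] conjI allI)
    show "f \<in> carr (free_omega_algebra \<Omega> UNIV)"
      using t_mon by (simp add: free_omega_algebra_def f_def)
    show "linear_in X1 f" "linear_in X2 f"
      using degree by (simp_all add: linear_in_def f_def)
    show "v X1 \<in> carr A" "v X2 \<in> carr A" "v (Y j) \<in> carr A" for j
      using xs(3) zero_carr by (auto simp: v_def xs_eq subset_iff)
  qed (simp add: eval)
  with nz show ?L by blast
qed

end

section \<open>Graded algebras and their graded ideals\<close>

text \<open>
  Here every operation respects the grading, including the constants, which are thus even. It is
  the situation that arises from the theorem after passing to \<open>\<Omega>'\<close>.
\<close>

locale graded_algebra = omega_algebra \<Omega> A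
  for \<Omega> :: "'w signature" and A :: "('f::field, 'a::ab_group_add, 'w) omega_alg" +
  fixes G :: "bit \<Rightarrow> 'a set"
  assumes subspace_G: "subspace (G i)"
    and carr_eq: "carr A = {x + y | x y. x \<in> G 0 \<and> y \<in> G 1}"
    and G_Int: "G 0 \<inter> G 1 = {0}"
    and oper_homogeneous: "w \<in> \<Omega> (length xs) \<Longrightarrow> list_all2 (\<lambda>i x. x \<in> G i) js xs \<Longrightarrow>
        oper A w xs \<in> G (sum_list js)"
begin

lemma G_0: "0 \<in> G i"
  using subspace_G by (rule subspace_0)

lemma G_carr: "x \<in> G i \<Longrightarrow> x \<in> carr A"
  unfolding carr_eq by (cases i) (use G_0 in \<open>auto intro: exI[of _ x] exI[of _ 0]\<close>)

lemma homogeneous_carr: "list_all2 (\<lambda>i x. x \<in> G i) js xs \<Longrightarrow> set xs \<subseteq> carr A"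
  by (induction rule: list_all2_induct) (auto intro: G_carr)

lemma G_disjoint: "x \<in> G i \<Longrightarrow> x \<in> G (i + 1) \<Longrightarrow> x = 0"
  using G_Int by (cases i) auto

text \<open>A uniform description of both projections: the complementary component is \<open>x - y\<close>.\<close>

definition proj :: "bit \<Rightarrow> 'a \<Rightarrow> 'a" where
  "proj i x = (THE y. y \<in> G i \<and> x - y \<in> G (i + 1))"

lemma proj_eqI:
  assumes "y \<in> G i" "x - y \<in> G (i + 1)"
  shows "proj i x = y"
  unfolding proj_def
proof (rule the_equality)
  fix z assume z: "z \<in> G i \<and> x - z \<in> G (i + 1)"
  have "z - y \<in> G i" using z assms subspace_G by (simp add: subspace_diff)
  moreover have "(x - y) - (x - z) \<in> G (i + 1)"
    using z assms subspace_G by (blast intro: subspace_diff)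
  ultimately have "z - y = 0" by (intro G_disjoint) (simp_all add: algebra_simps)
  then show "z = y" by simp
qed (use assms in auto)

lemma proj_mem:
  assumes "x \<in> carr A"
  shows "proj i x \<in> G i" "x - proj i x \<in> G (i + 1)"
proof -
  have "\<exists>y. y \<in> G i \<and> x - y \<in> G (i + 1)"
  proof (cases "i = 0")
    case True
    then show ?thesis using assms unfolding carr_eq by force
  next
    case False
    from assms obtain y z where "x = y + z" "y \<in> G 0" "z \<in> G 1" unfolding carr_eq by auto
    then show ?thesis using False by (intro exI[of _ z]) simp
  qed
  then obtain y where y: "y \<in> G i" "x - y \<in> G (i + 1)" by auto
  with proj_eqI[OF y] show "proj i x \<in> G i" "x - proj i x \<in> G (i + 1)" by auto
qed

lemma proj_carr: "x \<in> carr A \<Longrightarrow> proj i x \<in> carr A"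
  using proj_mem(1) G_carr by blast

lemma proj_plus_proj:
  assumes "x \<in> carr A"
  shows "proj i x + proj (i + 1) x = x"
proof -
  have "proj (i + 1) x = x - proj i x"
    by (rule proj_eqI) (use proj_mem[OF assms, of i] in \<open>cases i; simp\<close>)+
  then show ?thesis by simp
qed

lemma proj_add:
  assumes "x \<in> carr A" "y \<in> carr A"
  shows "proj i (x + y) = proj i x + proj i y"
proof (rule proj_eqI)
  show "proj i x + proj i y \<in> G i"
    using assms proj_mem(1) subspace_G by (simp add: subspace_add)
  have "(x - proj i x) + (y - proj i y) \<in> G (i + 1)"
    using assms proj_mem(2) subspace_G by (simp add: subspace_add)
  then show "x + y - (proj i x + proj i y) \<in> G (i + 1)" by (simp add: algebra_simps)
qed

lemma proj_scale:
  assumes "x \<in> carr A"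
  shows "proj i (vscale A c x) = vscale A c (proj i x)"
proof (rule proj_eqI)
  show "vscale A c (proj i x) \<in> G i"
    using assms proj_mem(1) subspace_G by (simp add: subspace_scale)
  have "vscale A c (x - proj i x) \<in> G (i + 1)"
    using assms proj_mem(2) subspace_G by (simp add: subspace_scale)
  then show "vscale A c x - vscale A c (proj i x) \<in> G (i + 1)"
    by (simp add: scale_right_diff_distrib)
qed

lemma proj_same: "x \<in> G i \<Longrightarrow> proj i x = x"
  by (rule proj_eqI) (simp_all add: G_0)

lemma proj_other: "x \<in> G i \<Longrightarrow> proj (i + 1) x = 0"
  by (rule proj_eqI) (cases i; simp add: G_0)+

lemma oper_expand_proj:
  assumes "w \<in> \<Omega> (length xs)" "set xs \<subseteq> carr A"
  shows "oper A w xs = (\<Sum>js | length js = length xs. oper A w (map2 proj js xs))"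
  by (rule oper_expand[OF _ _ assms]) (use proj_plus_proj[of _ 0] in \<open>auto simp: proj_carr\<close>)

lemma list_all2_map2_proj:
  "length js = length xs \<Longrightarrow> set xs \<subseteq> carr A \<Longrightarrow> list_all2 (\<lambda>i x. x \<in> G i) js (map2 proj js xs)"
  by (induction js xs rule: list_induct2) (auto simp: proj_mem)

text \<open>
  Multilinear expansion reduces the ideal property of a graded subspace to homogeneous
  arguments.
\<close>

lemma graded_ideal_of_components:
  assumes sub: "\<And>i. subspace (H i)" and HG: "\<And>i. H i \<subseteq> G i"
    and op: "\<And>w js xs k. w \<in> \<Omega> (length xs) \<Longrightarrow> list_all2 (\<lambda>i x. x \<in> G i) js xs \<Longrightarrow>
      k < length xs \<Longrightarrow> xs ! k \<in> H (js ! k) \<Longrightarrow> oper A w xs \<in> H (sum_list js)"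
  shows "\<exists>K. omega_ideal \<Omega> A K \<and> graded_subset G K \<and> (\<forall>i. H i = K \<inter> G i)"
proof -
  define K where "K = {x \<in> carr A. \<forall>i. proj i x \<in> H i}"
  have HK: "x \<in> K" if x: "x \<in> H i" for x i
  proof -
    have "x \<in> G i" using x HG by auto
    moreover have "0 \<in> H (i + 1)" using sub by (rule subspace_0)
    moreover have "j = i \<or> j = i + 1" for j by (cases i; cases j) auto
    ultimately show ?thesis
      unfolding K_def using x G_carr proj_same proj_other by (smt (verit) mem_Collect_eq)
  qed
  have components: "H i = K \<inter> G i" for i
  proof (intro equalityI subsetI)
    fix x assume "x \<in> K \<inter> G i"
    then have "x \<in> K" and "proj i x = x" using proj_same by blast+
    moreover from \<open>x \<in> K\<close> have "proj i x \<in> H i" unfolding K_def by blast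
    ultimately show "x \<in> H i" by simp
  qed (use HK HG in blast)
  have K_add: "x + y \<in> K" if "x \<in> K" "y \<in> K" for x y
    using that sub subspace_carr by (simp add: K_def proj_add subspace_add)
  have K_0: "0 \<in> K" using HK[of 0 0] sub subspace_0 by blast
  have subspace_K: "subspace K"
    by (rule subspaceI)
       (use K_add K_0 sub subspace_carr in \<open>auto simp: K_def proj_scale subspace_scale\<close>)
  have "omega_ideal \<Omega> A K"
    unfolding omega_ideal_def
  proof (intro conjI allI ballI impI)
    fix n w xs assume n: "1 \<le> n" "w \<in> \<Omega> n" "length xs = n" "set xs \<subseteq> carr A" "\<exists>x\<in>set xs. x \<in> K"
    then obtain k where k: "k < length xs" "xs ! k \<in> K" by (auto simp: in_set_conv_nth)
    have "oper A w (map2 proj js xs) \<in> K" if js: "length js = length xs" for js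
      by (rule HK, rule op[of w _ js k])
         (use n k js list_all2_map2_proj[OF js] in \<open>auto simp: K_def\<close>)
    then have "(\<Sum>js | length js = length xs. oper A w (map2 proj js xs)) \<in> K"
      using subspace_K by (intro subspace_sum) auto
    then show "oper A w xs \<in> K" using oper_expand_proj n by simp
  qed (use subspace_K in \<open>auto simp: K_def\<close>)
  moreover have "graded_subset G K"
    unfolding graded_subset_def
  proof (intro equalityI subsetI)
    fix x assume x: "x \<in> K"
    then have "proj i x \<in> H i" for i unfolding K_def by blast
    then have "proj i x \<in> K \<inter> G i" for i using components by blast
    moreover have "x = proj 0 x + proj 1 x" using proj_plus_proj[of x 0] x by (simp add: K_def)
    ultimately show "x \<in> {x + y |x y. x \<in> K \<inter> G 0 \<and> y \<in> K \<inter> G 1}" by blast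
  qed (use K_add in auto)
  ultimately show ?thesis using components by blast
qed

end

section \<open>A nontrivial ideal of a graded-simple algebra\<close>

locale graded_simple_with_ideal = graded_algebra \<Omega> A G
  for \<Omega> :: "'w signature" and A :: "('f::field, 'a::ab_group_add, 'w) omega_alg"
    and G :: "bit \<Rightarrow> 'a set" +
  fixes I :: "'a set"
  assumes graded_ideals_trivial: "omega_ideal \<Omega> A K \<Longrightarrow> graded_subset G K \<Longrightarrow> K = {0} \<or> K = carr A"
    and ideal: "omega_ideal \<Omega> A I"
    and I_nonzero: "I \<noteq> {0}" and I_proper: "I \<noteq> carr A"
begin

lemma subspace_I: "subspace I" and I_carr: "I \<subseteq> carr A"
  using ideal by (auto simp: omega_ideal_def)

lemma graded_simple_components:
  assumes sub: "\<And>i. subspace (H i)" and HG: "\<And>i. H i \<subseteq> G i"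
    and op: "\<And>w js xs k. w \<in> \<Omega> (length xs) \<Longrightarrow> list_all2 (\<lambda>i x. x \<in> G i) js xs \<Longrightarrow>
      k < length xs \<Longrightarrow> xs ! k \<in> H (js ! k) \<Longrightarrow> oper A w xs \<in> H (sum_list js)"
  shows "(\<forall>i. H i = {0}) \<or> (\<forall>i. H i = G i)"
proof -
  have "\<exists>K. omega_ideal \<Omega> A K \<and> graded_subset G K \<and> (\<forall>i. H i = K \<inter> G i)"
    by (rule graded_ideal_of_components[OF sub HG]) (rule op)
  then obtain K where K: "omega_ideal \<Omega> A K" "graded_subset G K" "\<And>i. H i = K \<inter> G i" by blast
  from graded_ideals_trivial[OF K(1,2)] show ?thesis
    using K(3) G_0 G_carr by blast
qed

text \<open>
  The homogeneous elements of \<open>I\<close> span a graded ideal contained in \<open>I\<close>, and \<open>I\<close> is proper. This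
  gives the uniqueness of even and odd representatives modulo \<open>I\<close>.
\<close>

lemma I_homogeneous_zero:
  assumes "x \<in> I" "x \<in> G i"
  shows "x = 0"
proof -
  have op: "oper A w xs \<in> I" if "w \<in> \<Omega> (length xs)" "list_all2 (\<lambda>i x. x \<in> G i) js xs"
    "k < length xs" "xs ! k \<in> I" for w js xs k
    using omega_ideal_oper[OF ideal that(1) homogeneous_carr[OF that(2)] nth_mem[OF that(3)] that(4)] .
  have "(\<forall>i. I \<inter> G i = {0}) \<or> (\<forall>i. I \<inter> G i = G i)"
    by (rule graded_simple_components)
       (use op oper_homogeneous subspace_I subspace_G in \<open>auto simp: subspace_inter\<close>)
  moreover have "\<not> (\<forall>i. I \<inter> G i = G i)"
  proof
    assume "\<forall>i. I \<inter> G i = G i"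
    then have "G i \<subseteq> I" for i by blast
    then have "x \<in> I" if "x \<in> carr A" for x
      using that subspace_I unfolding carr_eq by (auto intro!: subspace_add)
    then show False using I_carr I_proper by blast
  qed
  ultimately show ?thesis using assms by blast
qed

text \<open>
  The homogeneous components of the elements of \<open>I\<close> span a graded ideal, which contains \<open>I \<noteq> 0\<close>
  and hence is all of \<open>A\<close>. For the ideal property: replacing a single argument \<open>x\<close> by a congruent
  \<open>y\<close> of the other parity changes the value of an operation to a congruent one, and flips its
  parity. The lemma gives the existence of even and odd representatives modulo \<open>I\<close>.
\<close>

lemma homogeneous_cong_opposite:
  assumes "x \<in> G i"
  shows "\<exists>y \<in> G (i + 1). x - y \<in> I"
proof -
  \<comment> \<open>This is the projection of \<open>I\<close> to the component of degree \<open>i\<close>, as \<open>G (i + 1)\<close> is closed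
      under negation.\<close>
  define H where "H i = {x \<in> G i. \<exists>y \<in> G (i + 1). x - y \<in> I}" for i
  have HG: "H i \<subseteq> G i" for i by (auto simp: H_def)
  have sub: "subspace (H i)" for i
  proof (rule subspaceI)
    show "0 \<in> H i"
      using G_0 subspace_0[OF subspace_I] unfolding H_def by (auto intro!: bexI[of _ 0])
    fix x y assume "x \<in> H i" "y \<in> H i"
    then obtain x' y' where *: "x \<in> G i" "y \<in> G i" "x' \<in> G (i + 1)" "y' \<in> G (i + 1)"
      "x - x' \<in> I" "y - y' \<in> I" unfolding H_def by auto
    have "x + y - (x' + y') \<in> I"
      using subspace_add[OF subspace_I *(5,6)] by (simp add: algebra_simps)
    then show "x + y \<in> H i"
      using * subspace_add[OF subspace_G] by (auto simp: H_def)
  next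
    fix c x assume "x \<in> H i"
    then obtain x' where *: "x \<in> G i" "x' \<in> G (i + 1)" "x - x' \<in> I" unfolding H_def by auto
    have "vscale A c x - vscale A c x' \<in> I"
      using subspace_scale[OF subspace_I *(3), of c] by (simp add: scale_right_diff_distrib)
    then show "vscale A c x \<in> H i"
      using * subspace_scale[OF subspace_G] by (auto simp: H_def)
  qed
  have op: "oper A w xs \<in> H (sum_list js)" if w: "w \<in> \<Omega> (length xs)"
    and homog: "list_all2 (\<lambda>i x. x \<in> G i) js xs"
    and k: "k < length xs" "xs ! k \<in> H (js ! k)" for w js xs k
  proof -
    from k obtain y where y: "y \<in> G (js ! k + 1)" "xs ! k - y \<in> I" unfolding H_def by auto
    have len: "length js = length xs" using homog by (rule list_all2_lengthD)
    have entries: "xs ! l \<in> G (js ! l)" if "l < length xs" for l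
      using homog that by (simp add: list_all2_conv_all_nth)
    have homog': "list_all2 (\<lambda>i x. x \<in> G i) (js[k := js ! k + 1]) (xs[k := y])"
      using homog y(1) by (intro list_all2_update_cong) auto
    have parity: "sum_list (js[k := js ! k + 1]) = sum_list js + 1"
      using k(1) len by (intro sum_list_update_add) simp
    have "oper A w (xs[k := y]) \<in> G (sum_list js + 1)"
      using oper_homogeneous[OF _ homog'] w parity by simp
    moreover have "oper A w xs - oper A w (xs[k := y]) \<in> I"
    proof (rule oper_cong_ideal[OF ideal w])
      show "list_all2 (\<lambda>x y. x \<in> carr A \<and> y \<in> carr A \<and> x - y \<in> I) xs (xs[k := y])"
        using y entries G_carr subspace_I k(1)
        by (auto simp: list_all2_conv_all_nth nth_list_update subspace_0)
    qed
    ultimately show ?thesis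
      using oper_homogeneous[OF w homog] by (auto simp: H_def)
  qed
  have "(\<forall>i. H i = {0}) \<or> (\<forall>i. H i = G i)"
    by (rule graded_simple_components[OF sub HG]) (rule op)
  moreover have "\<not> (\<forall>i. H i = {0})"
  proof
    assume H: "\<forall>i. H i = {0}"
    have "u = 0" if u: "u \<in> I" for u
    proof -
      have uc: "u \<in> carr A" using u I_carr by auto
      have "proj i u \<in> H i" for i
      proof -
        have "proj i u - - (u - proj i u) \<in> I" using u by simp
        then show ?thesis
          unfolding H_def using proj_mem[OF uc] subspace_neg[OF subspace_G] by blast
      qed
      then show ?thesis using H proj_plus_proj[OF uc, of 0] by simp
    qed
    then show False using I_nonzero subspace_0[OF subspace_I] by auto
  qed
  ultimately show ?thesis using assms unfolding H_def by blast
qed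

section \<open>The even representative of a coset\<close>

definition even_rep :: "'a \<Rightarrow> 'a" where
  "even_rep x = (THE y. y \<in> G 0 \<and> x - y \<in> I)"

lemma even_rep_eqI:
  assumes "y \<in> G 0" "x - y \<in> I"
  shows "even_rep x = y"
  unfolding even_rep_def
proof (rule the_equality)
  fix z assume z: "z \<in> G 0 \<and> x - z \<in> I"
  have "(x - y) - (x - z) \<in> I" using z assms subspace_I by (blast intro: subspace_diff)
  then have "z - y \<in> I" by simp
  moreover have "z - y \<in> G 0" using z assms subspace_G by (simp add: subspace_diff)
  ultimately have "z - y = 0" by (rule I_homogeneous_zero)
  then show "z = y" by simp
qed (use assms in auto)

lemma even_rep_mem:
  assumes x: "x \<in> carr A"
  shows "even_rep x \<in> G 0" "x - even_rep x \<in> I"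
proof -
  obtain y where y: "y \<in> G 0" "proj 1 x - y \<in> I"
    using homogeneous_cong_opposite[of "proj 1 x" 1] proj_mem(1)[OF x] by auto
  have "proj 0 x + y \<in> G 0"
    using y proj_mem(1)[OF x] subspace_G by (simp add: subspace_add)
  moreover have "proj 0 x + proj 1 x - (proj 0 x + y) \<in> I" using y(2) by simp
  moreover have "proj 0 x + proj 1 x = x" using proj_plus_proj[OF x, of 0] by simp
  ultimately have *: "proj 0 x + y \<in> G 0" "x - (proj 0 x + y) \<in> I" by simp_all
  with even_rep_eqI[OF *] show "even_rep x \<in> G 0" "x - even_rep x \<in> I" by auto
qed

lemma even_rep_even: "x \<in> G 0 \<Longrightarrow> even_rep x = x"
  by (rule even_rep_eqI) (simp_all add: subspace_0 subspace_I)

lemma even_rep_0: "even_rep 0 = 0"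
  by (simp add: even_rep_even G_0)

lemma even_rep_add:
  assumes "x \<in> carr A" "y \<in> carr A"
  shows "even_rep (x + y) = even_rep x + even_rep y"
proof (rule even_rep_eqI)
  show "even_rep x + even_rep y \<in> G 0"
    using assms even_rep_mem(1) subspace_G by (simp add: subspace_add)
  have "(x - even_rep x) + (y - even_rep y) \<in> I"
    using assms even_rep_mem(2) subspace_I by (simp add: subspace_add)
  then show "x + y - (even_rep x + even_rep y) \<in> I" by (simp add: algebra_simps)
qed

lemma even_rep_scale:
  assumes "x \<in> carr A"
  shows "even_rep (vscale A c x) = vscale A c (even_rep x)"
proof (rule even_rep_eqI)
  show "vscale A c (even_rep x) \<in> G 0"
    using assms even_rep_mem(1) subspace_G by (simp add: subspace_scale)
  have "vscale A c (x - even_rep x) \<in> I"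
    using assms even_rep_mem(2) subspace_I by (simp add: subspace_scale)
  then show "vscale A c x - vscale A c (even_rep x) \<in> I"
    by (simp add: scale_right_diff_distrib)
qed

lemma oper_even:
  assumes "w \<in> \<Omega> (length xs)" "set xs \<subseteq> G 0"
  shows "oper A w xs \<in> G 0"
proof -
  have "list_all2 (\<lambda>i x. x \<in> G i) (replicate (length xs) 0) xs"
    using assms(2) by (auto simp: list_all2_conv_all_nth)
  from oper_homogeneous[OF assms(1) this] show ?thesis by (simp add: sum_list_replicate)
qed

text \<open>Both sides are even and congruent modulo \<open>I\<close>.\<close>

lemma even_rep_oper:
  assumes "w \<in> \<Omega> (length xs)" "set xs \<subseteq> carr A"
  shows "even_rep (oper A w xs) = oper A w (map even_rep xs)"
proof (rule even_rep_eqI)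
  show "oper A w (map even_rep xs) \<in> G 0"
    by (rule oper_even) (use assms even_rep_mem(1) in auto)
  show "oper A w xs - oper A w (map even_rep xs) \<in> I"
  proof (rule oper_cong_ideal[OF ideal assms(1)])
    show "list_all2 (\<lambda>x y. x \<in> carr A \<and> y \<in> carr A \<and> x - y \<in> I) xs (map even_rep xs)"
      using assms(2) by (induction xs) (auto intro: even_rep_mem G_carr)
  qed
qed

lemma even_rep_eq_0:
  assumes "x \<in> G i" "even_rep x = 0"
  shows "x = 0"
proof (rule I_homogeneous_zero)
  show "x \<in> I" using even_rep_mem(2)[OF G_carr[OF assms(1)]] assms(2) by simp
qed (rule assms(1))

lemma even_rep_surj:
  assumes "b \<in> G 0"
  shows "\<exists>x \<in> G i. even_rep x = b"
proof (cases "i = 0")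
  case True
  then show ?thesis using assms even_rep_even by blast
next
  case False
  obtain x where x: "x \<in> G 1" "b - x \<in> I"
    using homogeneous_cong_opposite[OF assms] by auto
  have "x - b \<in> I" using subspace_neg[OF subspace_I x(2)] by simp
  then have "even_rep x = b" by (rule even_rep_eqI[OF assms])
  then show ?thesis using False x(1) by auto
qed

section \<open>The isomorphism with the tensor product\<close>

definition even_part :: "('f, 'a, 'w) omega_alg" where
  "even_part = A\<lparr>carr := G 0\<rparr>"

lemma even_part_simps [simp]:
  "carr even_part = G 0" "vscale even_part = vscale A" "oper even_part = oper A"
  by (simp_all add: even_part_def)

lemma omega_algebra_even_part: "omega_algebra \<Omega> even_part"
proof -
  have "set xs \<subseteq> G 0 \<Longrightarrow> set xs \<subseteq> carr A" for xs using G_carr by auto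
  then show ?thesis
    unfolding omega_algebra_def omega_algebra_axioms_def even_part_simps
    using vector_space_axioms subspace_G oper_even oper_add oper_scale G_carr by simp
qed

lemma eps_zero: "eps i 0 = 0"
  by (simp add: eps_def zero_prod_def)

text \<open>The map \<open>x \<mapsto> T (p\<^sub>0 x) + \<epsilon> T (p\<^sub>1 x)\<close>, where \<open>T\<close> is \<open>even_rep\<close>.\<close>

definition iso :: "'a \<Rightarrow> 'a \<times> 'a" where
  "iso x = (even_rep (proj 0 x), even_rep (proj 1 x))"

lemma component_iso: "component i (iso x) = even_rep (proj i x)"
  by (cases i) (auto simp: component_def iso_def)

lemma iso_homogeneous: "x \<in> G i \<Longrightarrow> iso x = eps i (even_rep x)"
  using proj_same[of x i] proj_other[of x i] even_rep_0
  by (cases i) (auto simp: iso_def eps_def)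

lemma iso_add: "x \<in> carr A \<Longrightarrow> y \<in> carr A \<Longrightarrow> iso (x + y) = iso x + iso y"
  by (simp add: iso_def proj_add even_rep_add proj_carr)

lemma iso_0: "iso 0 = 0"
  using iso_homogeneous[OF G_0, of 0] even_rep_0 by (simp add: eps_def zero_prod_def)

lemma iso_sum:
  assumes "finite S" "\<And>s. s \<in> S \<Longrightarrow> g s \<in> carr A"
  shows "iso (\<Sum>s\<in>S. g s) = (\<Sum>s\<in>S. iso (g s))"
  using assms
  by (induction rule: finite_induct)
     (auto simp: iso_0 iso_add subspace_sum[OF subspace_carr])

text \<open>
  Each term \<open>\<omega>(p\<^sub>i\<^sub>1 x\<^sub>1, \<dots>, p\<^sub>i\<^sub>n x\<^sub>n)\<close> of the expansion is homogeneous of degree \<open>i\<^sub>1 + \<dots> + i\<^sub>n\<close>, and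
  \<open>even_rep\<close> commutes with \<open>\<omega>\<close>.
\<close>

lemma iso_oper:
  assumes w: "w \<in> \<Omega> (length xs)" and xs: "set xs \<subseteq> carr A"
  shows "iso (oper A w xs) = (\<Sum>js | length js = length xs.
    eps (sum_list js) (oper A w (map2 component js (map iso xs))))"
proof -
  have homog: "oper A w (map2 proj js xs) \<in> G (sum_list js)" if "length js = length xs" for js
    by (rule oper_homogeneous) (use w that list_all2_map2_proj[OF that xs] in auto)
  have "iso (oper A w (map2 proj js xs))
      = eps (sum_list js) (oper A w (map2 component js (map iso xs)))"
    if js: "length js = length xs" for js
  proof -
    have "set (map2 proj js xs) \<subseteq> carr A"
      using xs proj_carr by (auto dest!: set_zip_rightD)
    then have "even_rep (oper A w (map2 proj js xs))
        = oper A w (map even_rep (map2 proj js xs))"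
      using even_rep_oper w js by simp
    also have "map even_rep (map2 proj js xs) = map2 component js (map iso xs)"
      using js by (auto simp: list_eq_iff_nth_eq component_iso)
    finally show ?thesis using iso_homogeneous[OF homog[OF js]] by simp
  qed
  then have "(\<Sum>js | length js = length xs. iso (oper A w (map2 proj js xs)))
      = (\<Sum>js | length js = length xs. eps (sum_list js) (oper A w (map2 component js (map iso xs))))"
    by (intro sum.cong) auto
  moreover have "iso (oper A w xs) = (\<Sum>js | length js = length xs. iso (oper A w (map2 proj js xs)))"
    unfolding oper_expand_proj[OF w xs]
    by (rule iso_sum) (use finite_bit_lists homog G_carr in auto)
  ultimately show ?thesis by simp
qed

lemma iso_eq_0:
  assumes x: "x \<in> carr A" and "iso x = 0"
  shows "x = 0"
proof -
  have "proj 0 x = 0" "proj 1 x = 0"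
    using assms(2) even_rep_eq_0[OF proj_mem(1)[OF x]] by (auto simp: iso_def zero_prod_def)
  then show ?thesis using proj_plus_proj[OF x, of 0] by simp
qed

lemma inj_on_iso: "inj_on iso (carr A)"
proof (rule inj_onI)
  fix x y assume x: "x \<in> carr A" and y: "y \<in> carr A" and eq: "iso x = iso y"
  have xy: "x - y \<in> carr A" using x y subspace_carr by (simp add: subspace_diff)
  have "iso (x - y) + iso y = iso x" using iso_add[OF xy y] by simp
  then have "x - y = 0" using iso_eq_0[OF xy] eq by simp
  then show "x = y" by simp
qed

lemma iso_image_G: "iso ` G i = eps i ` G 0"
proof -
  have "even_rep ` G i = G 0"
    using even_rep_surj[of _ i] even_rep_mem(1) G_carr by (fastforce simp: image_iff)
  moreover have "iso ` G i = eps i ` even_rep ` G i"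
    by (auto simp: iso_homogeneous image_iff)
  ultimately show ?thesis by simp
qed

lemma iso_image_carr: "iso ` carr A = G 0 \<times> G 0"
proof (intro equalityI subsetI)
  fix p assume "p \<in> G 0 \<times> G 0"
  then obtain b c where p: "p = (b, c)" "b \<in> G 0" "c \<in> G 0" by auto
  obtain x where x: "x \<in> G 0" "iso x = eps 0 b"
    using iso_image_G[of 0] p(2) by (metis (no_types, lifting) imageE imageI)
  obtain y where y: "y \<in> G 1" "iso y = eps 1 c"
    using iso_image_G[of 1] p(3) by (metis (no_types, lifting) imageE imageI)
  have "iso (x + y) = p"
    using x y p(1) G_carr by (simp add: iso_add eps_def)
  moreover have "x + y \<in> carr A" using x y unfolding carr_eq by blast
  ultimately show "p \<in> iso ` carr A" by blast
qed (auto simp: iso_def even_rep_mem proj_carr)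

lemma graded_isomorphic_even_part:
  "graded_isomorphic \<Omega> A G (tensor_FZ2 even_part) (tensor_FZ2_grading even_part)"
  unfolding graded_isomorphic_def
proof (intro exI[of _ iso] conjI allI)
  show "omega_hom \<Omega> A (tensor_FZ2 even_part) iso"
    using iso_image_carr iso_oper
    by (auto simp: omega_hom_def tensor_FZ2_def iso_add)
       (simp add: iso_def proj_scale even_rep_scale proj_carr)
  show "bij_betw iso (carr A) (carr (tensor_FZ2 even_part))"
    using inj_on_iso iso_image_carr by (simp add: bij_betw_def tensor_FZ2_def)
  show "iso ` G i = tensor_FZ2_grading even_part i" for i
    by (simp add: iso_image_G tensor_FZ2_grading_def)
qed

section \<open>Simplicity of the even part\<close>

text \<open>
  The components of the graded ideal to which \<open>J\<close> is pulled back are the preimages of \<open>J\<close> under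
  \<open>even_rep\<close> in \<open>G 0\<close> and \<open>G 1\<close>; the first of them is \<open>J\<close> itself.
\<close>

lemma ideal_even_part_trivial:
  assumes J: "omega_ideal \<Omega> even_part J"
  shows "J = {0} \<or> J = G 0"
proof -
  have subJ: "subspace J" and JG: "J \<subseteq> G 0" using J by (auto simp: omega_ideal_def)
  define H where "H i = {x \<in> G i. even_rep x \<in> J}" for i
  have H0: "H 0 = J" using JG even_rep_even by (auto simp: H_def)
  have HG: "H i \<subseteq> G i" for i by (auto simp: H_def)
  have sub: "subspace (H i)" for i
    by (rule subspaceI)
       (auto simp: H_def G_0 even_rep_0 even_rep_add even_rep_scale G_carr
          subspace_0[OF subJ] subspace_add[OF subJ] subspace_scale[OF subJ]
          subspace_add[OF subspace_G] subspace_scale[OF subspace_G])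
  have op: "oper A w xs \<in> H (sum_list js)" if w: "w \<in> \<Omega> (length xs)"
    and homog: "list_all2 (\<lambda>i x. x \<in> G i) js xs"
    and k: "k < length xs" "xs ! k \<in> H (js ! k)" for w js xs k
  proof -
    have xs: "set xs \<subseteq> carr A" using homog by (rule homogeneous_carr)
    have "even_rep (xs ! k) \<in> set (map even_rep xs)" using k(1) by simp
    moreover have "even_rep (xs ! k) \<in> J" using k(2) by (simp add: H_def)
    moreover have "set (map even_rep xs) \<subseteq> G 0" using xs even_rep_mem(1) by auto
    moreover have "1 \<le> length xs" using k(1) by simp
    ultimately have "oper A w (map even_rep xs) \<in> J"
      using J w unfolding omega_ideal_def even_part_simps by (metis length_map)
    then show ?thesis
      using oper_homogeneous[OF w homog] even_rep_oper[OF w xs] by (simp add: H_def)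
  qed
  have "(\<forall>i. H i = {0}) \<or> (\<forall>i. H i = G i)"
    by (rule graded_simple_components[OF sub HG]) (rule op)
  then show ?thesis using H0 by auto
qed

lemma simple_even_part:
  assumes "set_product \<Omega> A (carr A) (carr A) \<noteq> {0}"
  shows "simple_algebra \<Omega> even_part"
proof -
  interpret B: omega_algebra \<Omega> even_part by (rule omega_algebra_even_part)
  from assms obtain w xs where w: "2 \<le> length xs" "w \<in> \<Omega> (length xs)"
    and xs: "set xs \<subseteq> carr A" and nz: "oper A w xs \<noteq> 0"
    unfolding set_product_nonzero_iff by blast
  have "iso (oper A w xs) \<noteq> 0"
    using iso_eq_0 oper_closed[OF w(2) xs] nz by blast
  \<comment> \<open>Hence some summand of the expansion of \<open>iso (oper A w xs)\<close> is nonzero, and its arguments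
      are even.\<close>
  then obtain js where js: "length js = length xs"
    and "eps (sum_list js) (oper A w (map2 component js (map iso xs))) \<noteq> 0"
    unfolding iso_oper[OF w(2) xs] by (metis (mono_tags, lifting) mem_Collect_eq sum.neutral)
  then have nz': "oper A w (map2 component js (map iso xs)) \<noteq> 0"
    by (metis eps_zero)
  have "set (map2 component js (map iso xs)) \<subseteq> G 0"
  proof
    fix b assume "b \<in> set (map2 component js (map iso xs))"
    then obtain k where "k < length xs" "b = map2 component js (map iso xs) ! k"
      using js by (metis in_set_conv_nth length_map map_fst_zip)
    then have "k < length xs" "b = even_rep (proj (js ! k) (xs ! k))"
      using js by (simp_all add: component_iso)
    then show "b \<in> G 0" using xs nth_mem even_rep_mem(1) proj_carr by blast
  qed
  with nz' w js have "\<exists>w xs. 2 \<le> length xs \<and> w \<in> \<Omega> (length xs) \<and> set xs \<subseteq> G 0 \<and> oper A w xs \<noteq> 0"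
    by (intro exI[of _ w] exI[of _ "map2 component js (map iso xs)"]) simp
  then show ?thesis
    using B.set_product_nonzero_iff ideal_even_part_trivial omega_algebra_even_part
    by (simp add: simple_algebra_def)
qed

end

section \<open>Passage to the signature with even constants\<close>

lemma even_constants_signature_subset: "even_constants_signature \<Omega> A G n \<subseteq> \<Omega> n"
  by (simp add: even_constants_signature_def)

lemma even_constants_signature_pos: "1 \<le> n \<Longrightarrow> even_constants_signature \<Omega> A G n = \<Omega> n"
  by (simp add: even_constants_signature_def)

text \<open>An ideal has to absorb the operations of positive arity, and there the signatures agree.\<close>

lemma omega_ideal_even_constants:
  "omega_ideal (even_constants_signature \<Omega> A G) A I \<longleftrightarrow> omega_ideal \<Omega> A I"
  by (auto simp: omega_ideal_def even_constants_signature_pos)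

lemma graded_algebra_even_constants:
  assumes "omega_algebra \<Omega> A" "z2_grading \<Omega> A G"
  shows "graded_algebra (even_constants_signature \<Omega> A G) A G"
proof -
  interpret omega_algebra \<Omega> A by (rule assms(1))
  have op: "oper A w xs \<in> G (sum_list js)"
    if "w \<in> even_constants_signature \<Omega> A G (length xs)" "list_all2 (\<lambda>i x. x \<in> G i) js xs"
    for w xs js
  proof (cases xs)
    case Nil
    then show ?thesis using that by (simp add: even_constants_signature_def)
  next
    case (Cons y ys)
    then have pos: "1 \<le> length xs" by simp
    then have "w \<in> \<Omega> (length xs)" using that(1) by (simp add: even_constants_signature_pos)
    with pos that(2) list_all2_lengthD[OF that(2)] assms(2) show ?thesis
      unfolding z2_grading_def by blast
  qed
  have sub: "w \<in> \<Omega> n" if "w \<in> even_constants_signature \<Omega> A G n" for w n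
    using that by (rule subsetD[OF even_constants_signature_subset])
  show ?thesis
  proof (intro graded_algebra.intro omega_algebra.intro omega_algebra_axioms.intro
      graded_algebra_axioms.intro)
    show "module.subspace (vscale A) (G i)" for i
      using assms(2) unfolding z2_grading_def by blast
    show "carr A = {x + y | x y. x \<in> G 0 \<and> y \<in> G 1}" "G 0 \<inter> G 1 = {0}"
      using assms(2) by (simp_all only: z2_grading_def)
    show "vector_space (vscale A)" "module.subspace (vscale A) (carr A)"
      by (fact vector_space_axioms subspace_carr)+
  qed (rule oper_closed oper_add oper_scale op, (erule sub | assumption)+)+
qed

theorem theorem26:
  fixes \<Omega> :: "'w signature"
    and A :: "('f::field, 'a::ab_group_add, 'w) omega_alg"
    and G :: "bit \<Rightarrow> 'a set"
  assumes "\<exists>n\<ge>2. \<Omega> n \<noteq> {}"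
    and "CHAR('f) \<noteq> 2"
    and "omega_algebra \<Omega> A"
    and "z2_grading \<Omega> A G"
    and "graded_simple \<Omega> A G"
  shows "simple_algebra \<Omega> A \<or>
    (\<exists>B :: ('f, 'a, 'w) omega_alg.
       simple_algebra (even_constants_signature \<Omega> A G) B \<and>
       graded_isomorphic (even_constants_signature \<Omega> A G)
         A G (tensor_FZ2 B) (tensor_FZ2_grading B))"
proof (cases "simple_algebra \<Omega> A")
  case False
  let ?\<Omega>' = "even_constants_signature \<Omega> A G"
  interpret O: omega_algebra \<Omega> A by (rule assms(3))
  have nz: "set_product \<Omega> A (carr A) (carr A) \<noteq> {0}"
    and triv: "\<And>K. omega_ideal \<Omega> A K \<Longrightarrow> graded_subset G K \<Longrightarrow> K = {0} \<or> K = carr A"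
    using assms(5) by (auto simp: graded_simple_def)
  from False nz assms(3) obtain I where I: "omega_ideal \<Omega> A I" "I \<noteq> {0}" "I \<noteq> carr A"
    by (auto simp: simple_algebra_def)
  interpret graded_algebra ?\<Omega>' A G
    by (rule graded_algebra_even_constants[OF assms(3,4)])
  interpret graded_simple_with_ideal ?\<Omega>' A G I
    by unfold_locales (use I triv in \<open>auto simp: omega_ideal_even_constants\<close>)
  have "set_product ?\<Omega>' A (carr A) (carr A) \<noteq> {0}"
    using nz unfolding O.set_product_nonzero_iff set_product_nonzero_iff
    by (metis even_constants_signature_pos le_trans one_le_numeral)
  then show ?thesis
    using simple_even_part graded_isomorphic_even_part by blast
qed simp

end
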